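(* It is not true that for all integers $n\ge 2a\ge 2b\ge 4$, all non-trivial cross-intersecting families $\mathcal A\subset\binom{[n]}{a}$, $\mathcal B\subset\binom{[n]}{b}$ satisfy $|\mathcal A||\mathcal B|\le|\mathcal A_0||\mathcal B_0|$. More precisely, for $a=9$, $b=3$, $n=18$, the families $$\mathcal C_a=\Big\{C\in\tbinom{[n]}{a}:\{1,2\}\subset C\Big\}\cup\{[3,a+2]\},$$ $$\mathcal C_b=\Big\{C\in\tbinom{[n]}{b}:\{i,j\}\subset C\text{ for some } i\in\{1,2\},\ j\in[3,a+2]\Big\}$$ are non-trivial cross-intersecting and satisfy $|\mathcal C_a||\mathcal C_b|>|\mathcal A_0||\mathcal B_0|$.
   Context: $[n]=\{1,\dots,n\}$, $[p,q]=\{p,p+1,\dots,q\}$, and $\binom{X}{k}$ is the collection of $k$-subsets of $X$. A family is a star if all members contain a common element. Families are non-trivial cross-intersecting if every member of one meets every member of the other and neither family is a star. For integers $n\ge 2a\ge2b\ge4$, fix $A_0\in\binom{[2,n]}{a}$ and $B_0\in\binom{[2,n]}{b}$ with $A_0\cap B_0\ne\emptyset$ and put $\mathcal A_0=\{A_0\}\cup\{A\in\binom{[n]}{a}:1\in A,\ A\cap B_0\neq\emptyset\}$ and $\mathcal B_0=\{B_0\}\cup\{B\in\binom{[n]}{b}:1\in B,\ B\cap A_0\ne\emptyset\}$ (the sizes of $\mathcal A_0,\mathcal B_0$ do not depend on the choice of $A_0,B_0$). *)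

theory Defs
  imports Main "HOL-Library.Ramsey"
begin

definition star :: "nat set set \<Rightarrow> bool" where
  "star F \<longleftrightarrow> (\<exists>x. \<forall>A\<in>F. x \<in> A)"

definition nontrivial_cross_intersecting :: "nat set set \<Rightarrow> nat set set \<Rightarrow> bool" where
  "nontrivial_cross_intersecting F G \<longleftrightarrow>
     (\<forall>A\<in>F. \<forall>B\<in>G. A \<inter> B \<noteq> {}) \<and> \<not> star F \<and> \<not> star G"

(* The choice of the pair (A0, B0) is made explicit by the following predicate and by
   parameters of the two families. *)
definition base_pair :: "nat \<Rightarrow> nat \<Rightarrow> nat \<Rightarrow> nat set \<Rightarrow> nat set \<Rightarrow> bool" where
  "base_pair n a b A0 B0 \<longleftrightarrow>
     A0 \<in> nsets {2..n} a \<and> B0 \<in> nsets {2..n} b \<and> A0 \<inter> B0 \<noteq> {}"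

definition family_A0 :: "nat \<Rightarrow> nat \<Rightarrow> nat set \<Rightarrow> nat set \<Rightarrow> nat set set" where
  "family_A0 n a A0 B0 = {A0} \<union> {A \<in> nsets {1..n} a. 1 \<in> A \<and> A \<inter> B0 \<noteq> {}}"

definition family_B0 :: "nat \<Rightarrow> nat \<Rightarrow> nat set \<Rightarrow> nat set \<Rightarrow> nat set set" where
  "family_B0 n b A0 B0 = {B0} \<union> {B \<in> nsets {1..n} b. 1 \<in> B \<and> B \<inter> A0 \<noteq> {}}"

definition family_Ca :: "nat \<Rightarrow> nat \<Rightarrow> nat set set" where
  "family_Ca n a = {C \<in> nsets {1..n} a. {1, 2} \<subseteq> C} \<union> {{3..a + 2}}"

definition family_Cb :: "nat \<Rightarrow> nat \<Rightarrow> nat \<Rightarrow> nat set set" where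
  "family_Cb n a b = {C \<in> nsets {1..n} b. \<exists>i\<in>{1, 2}. \<exists>j\<in>{3..a + 2}. {i, j} \<subseteq> C}"

end

theory Submission
  imports Defs
begin

text \<open>Up to one extra set, each of the four families is a family of sets that contain a fixed set S
  and meet a fixed set T, or (for the family of 3-sets in the counterexample) a union of two such families.
  These are counted by complementation and inclusion-exclusion. For n = 18, a = 9, b = 3 this gives
  21308 * 109 = 2322572 for the base families and 11441 * 207 = 2368287 for the competing ones.\<close>

text \<open>Deleting \<open>S\<close> is a bijection onto the subsets of \<open>X - S\<close> of
  size \<open>k - card S\<close>. Without \<open>card S \<le> k\<close> the truncated difference
  would be 0 and the right side 1, although no such \<open>C\<close> exists.\<close>

lemma card_nsets_supset:
  assumes "finite X" "S \<subseteq> X" "card S \<le> k"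
  shows "card {C \<in> nsets X k. S \<subseteq> C} = (card X - card S) choose (k - card S)"
proof -
  have fS: "finite S" using assms finite_subset by blast
  have "bij_betw (\<lambda>C. C - S) {C \<in> nsets X k. S \<subseteq> C} (nsets (X - S) (k - card S))"
  proof (rule bij_betwI[where g = "\<lambda>D. D \<union> S"])
    show "(\<lambda>C. C - S) \<in> {C \<in> nsets X k. S \<subseteq> C} \<rightarrow> nsets (X - S) (k - card S)"
      using fS by (auto simp: nsets_def card_Diff_subset)
    show "(\<lambda>D. D \<union> S) \<in> nsets (X - S) (k - card S) \<rightarrow> {C \<in> nsets X k. S \<subseteq> C}"
    proof
      fix D assume D: "D \<in> nsets (X - S) (k - card S)"
      then have "D \<inter> S = {}" "finite D" "card D = k - card S" by (auto simp: nsets_def)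
      then have "card (D \<union> S) = k" using fS assms(3) by (simp add: card_Un_disjoint)
      then show "D \<union> S \<in> {C \<in> nsets X k. S \<subseteq> C}"
        using D fS assms(2) \<open>finite D\<close> by (auto simp: nsets_def)
    qed
  qed (auto simp: nsets_def)
  then have "card {C \<in> nsets X k. S \<subseteq> C} = card (nsets (X - S) (k - card S))"
    by (rule bij_betw_same_card)
  then show ?thesis
    using assms fS by (simp add: card_nsets card_Diff_subset)
qed

text \<open>Complementation: the sets that miss \<open>T\<close> are those drawn from
  \<open>X - T\<close>, so the previous count applies twice. Disjointness of \<open>S\<close> and
  \<open>T\<close> keeps \<open>S\<close> inside \<open>X - T\<close>.\<close>

lemma card_nsets_supset_meeting:
  assumes "finite X" "S \<subseteq> X" "T \<subseteq> X" "S \<inter> T = {}" "card S \<le> k"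
  shows "card {C \<in> nsets X k. S \<subseteq> C \<and> C \<inter> T \<noteq> {}} =
    ((card X - card S) choose (k - card S)) - ((card X - card T - card S) choose (k - card S))"
proof -
  have eq: "{C \<in> nsets X k. S \<subseteq> C \<and> C \<inter> T \<noteq> {}} =
      {C \<in> nsets X k. S \<subseteq> C} - {C \<in> nsets (X - T) k. S \<subseteq> C}"
    by (auto simp: nsets_def)
  have sub: "{C \<in> nsets (X - T) k. S \<subseteq> C} \<subseteq> {C \<in> nsets X k. S \<subseteq> C}"
    by (auto simp: nsets_def)
  have "finite {C \<in> nsets (X - T) k. S \<subseteq> C}"
    using assms(1) by (simp add: finite_imp_finite_nsets)
  moreover have "S \<subseteq> X - T" using assms by blast
  ultimately show ?thesis
    using assms unfolding eq
    by (simp add: card_Diff_subset[OF _ sub] card_nsets_supset card_Diff_subset finite_subset)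
qed

text \<open>The common shape of the two base families, with \<open>x\<close> = 1. The extra set
  \<open>E\<close> avoids \<open>x\<close>, hence is new and accounts for the
  \<open>Suc\<close>.\<close>

lemma card_insert_nsets_meeting:
  assumes "x \<notin> E" "x \<in> X" "T \<subseteq> X - {x}" "finite X" "1 \<le> k"
  shows "card ({E} \<union> {C \<in> nsets X k. x \<in> C \<and> C \<inter> T \<noteq> {}}) =
    Suc (((card X - 1) choose (k - 1)) - ((card X - card T - 1) choose (k - 1)))"
proof -
  have "card {C \<in> nsets X k. x \<in> C \<and> C \<inter> T \<noteq> {}} =
      ((card X - 1) choose (k - 1)) - ((card X - card T - 1) choose (k - 1))"
    using card_nsets_supset_meeting[of X "{x}" T k] assms by auto
  moreover have "finite {C \<in> nsets X k. x \<in> C \<and> C \<inter> T \<noteq> {}}"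
    using assms(4) by (simp add: finite_imp_finite_nsets)
  ultimately show ?thesis using assms(1) by simp
qed

text \<open>The value involves only \<open>n\<close>, \<open>a\<close> and \<open>b\<close>, so it
  is independent of the chosen pair. Here \<open>n - b - 1\<close> is the number of points outside
  \<open>B0\<close> other than 1.\<close>

lemma card_family_A0:
  assumes "base_pair n a b A0 B0" "1 \<le> a" "1 \<le> n"
  shows "card (family_A0 n a A0 B0) =
    Suc (((n - 1) choose (a - 1)) - ((n - b - 1) choose (a - 1)))"
  using assms card_insert_nsets_meeting[of 1 A0 "{1..n}" B0 a]
  by (fastforce simp: family_A0_def base_pair_def nsets_def)

lemma card_family_B0:
  assumes "base_pair n a b A0 B0" "1 \<le> b" "1 \<le> n"
  shows "card (family_B0 n b A0 B0) =
    Suc (((n - 1) choose (b - 1)) - ((n - a - 1) choose (b - 1)))"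
  using assms card_insert_nsets_meeting[of 1 B0 "{1..n}" A0 b]
  by (fastforce simp: family_B0_def base_pair_def nsets_def)

lemma card_family_Ca:
  assumes "2 \<le> a" "2 \<le> n"
  shows "card (family_Ca n a) = Suc ((n - 2) choose (a - 2))"
proof -
  have "card {C \<in> nsets {1..n} a. {1, 2} \<subseteq> C} = (n - 2) choose (a - 2)"
    using card_nsets_supset[of "{1..n}" "{1, 2}" a] assms by (simp add: numeral_2_eq_2)
  moreover have "finite {C \<in> nsets {1..n} a. {1, 2} \<subseteq> C}"
    by (simp add: finite_imp_finite_nsets)
  \<comment> \<open>The set \<open>{3..a + 2}\<close> does not contain 1, so it adds one new
    member.\<close>
  ultimately show ?thesis by (simp add: family_Ca_def numeral_2_eq_2)
qed

text \<open>Inclusion-exclusion over the two choices of \<open>i\<close>. The intersection term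
  stands on the left, which avoids a further truncated subtraction.\<close>

lemma card_family_Cb:
  assumes "2 \<le> b" "a + 2 \<le> n"
  shows "card (family_Cb n a b) + (((n - 2) choose (b - 2)) - ((n - a - 2) choose (b - 2))) =
    2 * (((n - 1) choose (b - 1)) - ((n - a - 1) choose (b - 1)))"
proof -
  define H where "H S = {C \<in> nsets {1..n} b. S \<subseteq> C \<and> C \<inter> {3..a + 2} \<noteq> {}}" for S
  \<comment> \<open>For \<open>S \<subseteq> {1, 2}\<close> the set \<open>S\<close> is disjoint
    from \<open>{3..a + 2}\<close> and has at most 2 \<le> \<open>b\<close> elements, as the general
    count requires.\<close>
  have card_H: "card (H S) = ((n - card S) choose (b - card S)) - ((n - a - card S) choose (b - card S))"
    if "S \<subseteq> {1, 2}" for S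
  proof -
    have "card S \<le> 2" using card_mono[OF _ that] by simp
    then show ?thesis
      using card_nsets_supset_meeting[of "{1..n}" S "{3..a + 2}" b] that assms
      unfolding H_def by fastforce
  qed
  have "family_Cb n a b = H {1} \<union> H {2}" "H {1} \<inter> H {2} = H {1, 2}"
    unfolding family_Cb_def H_def by auto
  moreover have "finite (H S)" for S
    by (simp add: H_def finite_imp_finite_nsets)
  ultimately have "card (family_Cb n a b) + card (H {1, 2}) = card (H {1}) + card (H {2})"
    by (metis card_Un_Int)
  then show ?thesis by (simp add: card_H numeral_2_eq_2)
qed

lemma not_star_if_disjoint:
  assumes "A \<in> F" "B \<in> F" "A \<inter> B = {}"
  shows "\<not> star F"
  using assms unfolding star_def by blast

lemma nontrivial_cross_intersecting_family_Ca_Cb: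
  "nontrivial_cross_intersecting (family_Ca 18 9) (family_Cb 18 9 3)"
proof -
  \<comment> \<open>If \<open>A\<close> contains 1 and 2, it meets \<open>B\<close> in
    \<open>i\<close>; if \<open>A\<close> is \<open>{3..11}\<close>, it meets \<open>B\<close> in
    \<open>j\<close>.\<close>
  have "A \<inter> B \<noteq> {}" if "A \<in> family_Ca 18 9" "B \<in> family_Cb 18 9 3" for A B
    using that unfolding family_Ca_def family_Cb_def by fastforce
  moreover have "\<not> star (family_Ca 18 9)"
  proof -
    \<comment> \<open>Outside \<open>{3..11}\<close> there are exactly 18 - 9 = 9 points, so their
      union is the one 9-set disjoint from it.\<close>
    have "{1, 2} \<union> {12..18} \<in> family_Ca 18 9" "{3..11} \<in> family_Ca 18 9"
      by (auto simp: family_Ca_def nsets_def card_Un_disjoint)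
    moreover have "({1, 2} \<union> {12..18}) \<inter> {3..11} = ({} :: nat set)" by auto
    ultimately show ?thesis by (rule not_star_if_disjoint)
  qed
  moreover have "\<not> star (family_Cb 18 9 3)"
  proof -
    \<comment> \<open>Each takes a different \<open>i\<close> and its other two points from
      \<open>{3..11}\<close>, so the two are disjoint.\<close>
    have "{1, 3, 4} \<in> family_Cb 18 9 3" "{2, 5, 6} \<in> family_Cb 18 9 3"
      by (auto simp: family_Cb_def nsets_def)
    moreover have "{1, 3, 4} \<inter> {2, 5, 6} = ({} :: nat set)" by auto
    ultimately show ?thesis by (rule not_star_if_disjoint)
  qed
  ultimately show ?thesis unfolding nontrivial_cross_intersecting_def by blast
qed

lemma family_A0_B0_less_family_Ca_Cb:
  assumes "base_pair 18 9 3 A0 B0"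
  shows "card (family_A0 18 9 A0 B0) * card (family_B0 18 3 A0 B0)
    < card (family_Ca 18 9) * card (family_Cb 18 9 3)"
proof -
  have choose: "(16::nat) choose 7 = 11440" "(17::nat) choose 8 = 24310" "(14::nat) choose 8 = 3003"
    "(17::nat) choose 2 = 136" "(8::nat) choose 2 = 28"
    by (simp_all add: binomial_fact' fact_numeral)
  have "card (family_A0 18 9 A0 B0) = 21308" "card (family_B0 18 3 A0 B0) = 109"
    using card_family_A0[OF assms] card_family_B0[OF assms] by (simp_all add: choose)
  moreover have "card (family_Ca 18 9) = 11441" "card (family_Cb 18 9 3) = 207"
    \<comment> \<open>For the 3-sets the formula reads
      \<open>card (family_Cb 18 9 3) + (16 - 7) = 2 * (136 - 28)\<close>.\<close>
    using card_family_Ca[of 9 18] card_family_Cb[of 3 9 18] by (simp_all add: choose)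
  ultimately show ?thesis by simp
qed

theorem mainTheorem3:
  shows "\<not> (\<forall>(n::nat) (a::nat) (b::nat). n \<ge> 2 * a \<and> 2 * a \<ge> 2 * b \<and> 2 * b \<ge> 4 \<longrightarrow>
           (\<forall>A0 B0. base_pair n a b A0 B0 \<longrightarrow>
             (\<forall>F G. F \<subseteq> nsets {1..n} a \<and> G \<subseteq> nsets {1..n} b \<and>
                nontrivial_cross_intersecting F G \<longrightarrow>
                card F * card G \<le> card (family_A0 n a A0 B0) * card (family_B0 n b A0 B0))))
       \<and>
         (\<forall>(n::nat) (a::nat) (b::nat). a = 9 \<and> b = 3 \<and> n = 18 \<longrightarrow>
           family_Ca n a \<subseteq> nsets {1..n} a \<and> family_Cb n a b \<subseteq> nsets {1..n} b \<and>
           nontrivial_cross_intersecting (family_Ca n a) (family_Cb n a b) \<and>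
           (\<forall>A0 B0. base_pair n a b A0 B0 \<longrightarrow>
             card (family_Ca n a) * card (family_Cb n a b)
               > card (family_A0 n a A0 B0) * card (family_B0 n b A0 B0)))"
proof -
  have sub: "family_Ca 18 9 \<subseteq> nsets {1..18} 9" "family_Cb 18 9 3 \<subseteq> nsets {1..18} 3"
    by (auto simp: family_Ca_def family_Cb_def nsets_def)
  \<comment> \<open>Refuting the bound needs some base pair at these parameters; this one shares the
    point 2.\<close>
  have bp: "base_pair 18 9 3 {2..10} {2..4}"
    by (auto simp: base_pair_def nsets_def)
  have "\<not> (\<forall>n a b. n \<ge> 2 * a \<and> 2 * a \<ge> 2 * b \<and> 2 * b \<ge> 4 \<longrightarrow>
      (\<forall>A0 B0. base_pair n a b A0 B0 \<longrightarrow>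
        (\<forall>F G. F \<subseteq> nsets {1..n} a \<and> G \<subseteq> nsets {1..n} b \<and>
          nontrivial_cross_intersecting F G \<longrightarrow>
          card F * card G \<le> card (family_A0 n a A0 B0) * card (family_B0 n b A0 B0))))"
    (is "\<not> (\<forall>n a b. ?bound n a b)")
  proof
    assume "\<forall>n a b. ?bound n a b"
    then have "?bound 18 9 3" by blast
    moreover have "(18::nat) \<ge> 2 * 9 \<and> 2 * 9 \<ge> 2 * (3::nat) \<and> 2 * 3 \<ge> (4::nat)" by linarith
    ultimately have "card (family_Ca 18 9) * card (family_Cb 18 9 3)
        \<le> card (family_A0 18 9 {2..10} {2..4}) * card (family_B0 18 3 {2..10} {2..4})"
      using bp sub nontrivial_cross_intersecting_family_Ca_Cb by blast
    then show False
      using family_A0_B0_less_family_Ca_Cb[OF bp] by linarith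
  qed
  then show ?thesis
    using sub nontrivial_cross_intersecting_family_Ca_Cb family_A0_B0_less_family_Ca_Cb by blast
qed

end
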